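(* Let $G$ be a second-price auction (in which bidders do not overbid). Then the coarse price of anarchy of the class of friendship extensions of $G$ is exactly $2$.
   Context: Second-price auction: $N$ is the set of bidders; bidder $i$ has a valuation $v_i\in\mathbb R_+$ for the (single) item and places a bid $b_i\in\mathbb R_+$ with $b_i\le v_i$ (no overbidding); $\Sigma_i$ is the set of bids of bidder $i$ and $\Sigma=\prod_{i\in N}\Sigma_i$ is the set of bidding profiles. The highest bidder $a(b)$ gets the item and pays the second-highest bid, while everybody else pays nothing. The social welfare is $\Pi(b)=v_{a(b)}$; the utility $\Pi_i(b)$ of bidder $i$ is $v_i$ minus his payment if $i=a(b)$, and $0$ otherwise. Friendship extension: for $\alpha\in[0,1]^{N\times N}$ with $\alpha_{ii}=1$ for all $i$, the $\alpha$-friendship extension $G^\alpha$ is the payoff-maximization game with the same players and strategies and utilities $\Pi_i^\alpha=\sum_{j\in N}\alpha_{ij}\Pi_j$; its social welfare is again $\Pi$. A coarse equilibrium of $G^\alpha$ is a probability distribution $\sigma$ on $\Sigma$ such that for all $i$ and all $t_i\in\Sigma_i$, $\mathbf E_{b\sim\sigma}[\Pi_i^\alpha(b)]\ge\mathbf E_{b\sim\sigma}[\Pi_i^\alpha(t_i,b_{-i})]$, where $(t_i,b_{-i})$ is $b$ with bidder $i$'s bid replaced by $t_i$. The coarse price of anarchy of $G^\alpha$ is $\sup_\sigma\Pi(b^* )/\mathbf E_{b\sim\sigma}[\Pi(b)]$, where $b^*$ maximizes $\Pi$ and $\sigma$ ranges over the coarse equilibria of $G^\alpha$. The coarse price of anarchy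 of a class of games is the supremum of the coarse prices of anarchy of the games in the class.
   Formalization: For a single auction G, "exactly 2" can fail (one bidder or equal valuations give 1); shown is at most 2 for every G, and exactly 2 for the class of friendship extensions of all auctions with given bidders (at least two) and a given measurable tie-breaking rule, valuations varying. *)

theory Defs
  imports "HOL-Probability.Probability"
begin

record ('i, 's) game =
  players :: "'i set"
  strategies :: "'i \<Rightarrow> 's set"
  payoff :: "'i \<Rightarrow> ('i \<Rightarrow> 's) \<Rightarrow> real"
  welfare :: "('i \<Rightarrow> 's) \<Rightarrow> real"

text \<open>Profiles are the extensional functions on the players, with the product of the Borel
  sigma-algebras of the strategy sets; probability distributions on profiles need not be discrete.\<close>

definition profiles :: "('i, 's) game \<Rightarrow> ('i \<Rightarrow> 's) set" where
  "profiles G = Pi\<^sub>E (players G) (strategies G)"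

definition profile_space :: "('i, 's::topological_space) game \<Rightarrow> ('i \<Rightarrow> 's) measure" where
  "profile_space G = Pi\<^sub>M (players G) (\<lambda>i. restrict_space borel (strategies G i))"

text \<open>The definition below is meant for bounded measurable payoffs, for which both
  expectations exist; this is the case for the auctions considered here.\<close>

definition coarse_equilibrium ::
    "('i, 's::topological_space) game \<Rightarrow> ('i \<Rightarrow> 's) measure \<Rightarrow> bool" where
  "coarse_equilibrium G \<sigma> \<longleftrightarrow>
     prob_space \<sigma> \<and> sets \<sigma> = sets (profile_space G) \<and>
     (\<forall>i\<in>players G. \<forall>t\<in>strategies G i.
        (\<integral>b. payoff G i b \<partial>\<sigma>) \<ge> (\<integral>b. payoff G i (b(i := t)) \<partial>\<sigma>))"

text \<open>Ratios are taken in the extended reals: a positive optimum over expected welfare zero counts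
  as infinity, and the degenerate ratio 0/0 counts as 0.\<close>

definition coarse_poa :: "('i, 's::topological_space) game \<Rightarrow> ereal" where
  "coarse_poa G =
     Sup {ereal (welfare G b_opt) / ereal (\<integral>b. welfare G b \<partial>\<sigma>) | b_opt \<sigma>.
            is_arg_max (welfare G) (\<lambda>b. b \<in> profiles G) b_opt \<and> coarse_equilibrium G \<sigma>}"

definition coarse_poa_class :: "('i, 's::topological_space) game set \<Rightarrow> ereal" where
  "coarse_poa_class C = (SUP G\<in>C. coarse_poa G)"

definition friendship_weights :: "'i set \<Rightarrow> ('i \<Rightarrow> 'i \<Rightarrow> real) \<Rightarrow> bool" where
  "friendship_weights N \<alpha> \<longleftrightarrow>
     (\<forall>i\<in>N. \<forall>j\<in>N. 0 \<le> \<alpha> i j \<and> \<alpha> i j \<le> 1) \<and> (\<forall>i\<in>N. \<alpha> i i = 1)"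

definition friendship_extension ::
    "('i \<Rightarrow> 'i \<Rightarrow> real) \<Rightarrow> ('i, 's) game \<Rightarrow> ('i, 's) game" where
  "friendship_extension \<alpha> G =
     G\<lparr>payoff := (\<lambda>i b. \<Sum>j\<in>players G. \<alpha> i j * payoff G j b)\<rparr>"

definition friendship_extensions :: "('i, 's) game \<Rightarrow> ('i, 's) game set" where
  "friendship_extensions G =
     {friendship_extension \<alpha> G | \<alpha>. friendship_weights (players G) \<alpha>}"

text \<open>A rule selecting a highest bidder, with an arbitrary but measurable way of breaking ties
  (measurability is needed for the expected payoffs to make sense).\<close>

definition highest_bidder_rule :: "'i set \<Rightarrow> (('i \<Rightarrow> real) \<Rightarrow> 'i) \<Rightarrow> bool" where
  "highest_bidder_rule N a \<longleftrightarrow>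
     a \<in> Pi\<^sub>M N (\<lambda>_. restrict_space borel {0..}) \<rightarrow>\<^sub>M count_space N \<and>
     (\<forall>b \<in> N \<rightarrow>\<^sub>E {0..}. a b \<in> N \<and> (\<forall>j\<in>N. b j \<le> b (a b)))"

text \<open>The second-highest bid, counted with multiplicity. As bids are nonnegative, the inserted 0
  only matters for a single bidder, who pays nothing.\<close>

definition second_highest_bid :: "'i set \<Rightarrow> (('i \<Rightarrow> real) \<Rightarrow> 'i) \<Rightarrow> ('i \<Rightarrow> real) \<Rightarrow> real" where
  "second_highest_bid N a b = Max (insert 0 (b ` (N - {a b})))"

definition second_price_auction ::
    "'i set \<Rightarrow> (('i \<Rightarrow> real) \<Rightarrow> 'i) \<Rightarrow> ('i \<Rightarrow> real) \<Rightarrow> ('i, real) game" where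
  "second_price_auction N a v =
     \<lparr>players = N,
      strategies = (\<lambda>i. {0..v i}),
      payoff = (\<lambda>i b. if i = a b then v i - second_highest_bid N a b else 0),
      welfare = (\<lambda>b. v (a b))\<rparr>"

end

theory Submission
  imports Defs
begin

text \<open>For the upper bound, let \<^term>\<open>k\<close> be any bidder and consider the deviation to a truthful bid.
  In every profile this gives \<^term>\<open>k\<close> at least \<^term>\<open>v k\<close> minus the highest bid of the others,
  which without overbidding is at most the welfare, while the extended utility of \<^term>\<open>k\<close> without
  deviating is at most the welfare. Hence \<^term>\<open>v k\<close> is at most twice the expected welfare of any
  coarse equilibrium. For the lower bound, bidder \<^term>\<open>p\<close> with valuation 2 bids 0, bidder
  \<^term>\<open>q\<close> with valuation 1 bids 1, and \<^term>\<open>p\<close> cares fully about \<^term>\<open>q\<close>: outbidding \<^term>\<open>q\<close>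
  is worth only 1 to \<^term>\<open>p\<close>, no more than the utility of \<^term>\<open>q\<close>.\<close>

section \<open>Projections of the games, profile spaces and point masses\<close>

lemma players_auction [simp]: "players (second_price_auction N a v) = N"
  and strategies_auction [simp]: "strategies (second_price_auction N a v) i = {0..v i}"
  and welfare_auction [simp]: "welfare (second_price_auction N a v) = (\<lambda>b. v (a b))"
  and payoff_auction: "payoff (second_price_auction N a v) i b =
    (if i = a b then v i - second_highest_bid N a b else 0)"
  by (simp_all add: second_price_auction_def)

lemma players_extension [simp]: "players (friendship_extension \<alpha> G) = players G"
  and strategies_extension [simp]: "strategies (friendship_extension \<alpha> G) = strategies G"
  and welfare_extension [simp]: "welfare (friendship_extension \<alpha> G) = welfare G"
  and payoff_extension: "payoff (friendship_extension \<alpha> G) i b =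
    (\<Sum>j\<in>players G. \<alpha> i j * payoff G j b)"
  by (simp_all add: friendship_extension_def)

lemma space_profile_space: "space (profile_space G) = profiles G"
  by (simp add: profile_space_def profiles_def space_PiM space_restrict_space)

lemma profile_space_extension [simp]: "profile_space (friendship_extension \<alpha> G) = profile_space G"
  and profiles_extension [simp]: "profiles (friendship_extension \<alpha> G) = profiles G"
  by (simp_all add: profile_space_def profiles_def)

lemma profiles_upd:
  "b \<in> profiles G \<Longrightarrow> i \<in> players G \<Longrightarrow> t \<in> strategies G i \<Longrightarrow> b(i := t) \<in> profiles G"
  by (auto simp: profiles_def PiE_iff extensional_def)

lemma measurable_profile_upd:
  assumes "i \<in> players G" "t \<in> strategies G i"
  shows "(\<lambda>b. b(i := t)) \<in> profile_space G \<rightarrow>\<^sub>M profile_space G"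
  unfolding profile_space_def
  by (rule measurable_fun_upd[where J = "players G"])
    (use assms in \<open>auto simp: space_restrict_space\<close>)

text \<open>Turns a pure Nash equilibrium into a coarse one: under the point mass at
  \<open>b\<close> both expectations collapse to values at \<open>b\<close> and
  \<open>b(i := t)\<close>, so a single profile can witness the lower bound.\<close>

lemma coarse_equilibrium_return:
  assumes b: "b \<in> profiles G"
    and meas: "\<And>i. i \<in> players G \<Longrightarrow> payoff G i \<in> borel_measurable (profile_space G)"
    and nash: "\<And>i t. i \<in> players G \<Longrightarrow> t \<in> strategies G i \<Longrightarrow>
      payoff G i (b(i := t)) \<le> payoff G i b"
  shows "coarse_equilibrium G (return (profile_space G) b)"
proof -
  have b': "b \<in> space (profile_space G)"
    using b by (simp add: space_profile_space)
  have "(\<integral>x. payoff G i (x(i := t)) \<partial>return (profile_space G) b) = payoff G i (b(i := t))"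
    if "i \<in> players G" "t \<in> strategies G i" for i t
    using measurable_compose[OF measurable_profile_upd[OF that] meas[OF that(1)]]
    by (rule integral_return[OF b'])
  then show ?thesis
    using nash b' by (auto simp: coarse_equilibrium_def prob_space_return integral_return meas)
qed

section \<open>Winner, second price and welfare\<close>

locale auction =
  fixes N :: "'i set" and a :: "('i \<Rightarrow> real) \<Rightarrow> 'i" and v :: "'i \<Rightarrow> real"
  assumes finite_N: "finite N" and rule_a: "highest_bidder_rule N a"
begin

abbreviation "G \<equiv> second_price_auction N a v"

lemma profile_nonneg: "b \<in> profiles G \<Longrightarrow> b \<in> N \<rightarrow>\<^sub>E {0..}"
  by (auto simp: profiles_def PiE_iff)

lemma profile_bounds: "b \<in> profiles G \<Longrightarrow> j \<in> N \<Longrightarrow> 0 \<le> b j \<and> b j \<le> v j"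
  by (auto simp: profiles_def PiE_iff)

lemma winner_in: "b \<in> profiles G \<Longrightarrow> a b \<in> N"
  and winner_max: "b \<in> profiles G \<Longrightarrow> j \<in> N \<Longrightarrow> b j \<le> b (a b)"
  using rule_a profile_nonneg by (auto simp: highest_bidder_rule_def)

text \<open>Ties are broken arbitrarily by \<open>a\<close>, so strict inequalities are what pins
  the winner down.\<close>

lemma winner_eqI:
  assumes "b \<in> profiles G" "i \<in> N" "\<And>j. j \<in> N \<Longrightarrow> j \<noteq> i \<Longrightarrow> b j < b i"
  shows "a b = i"
  using winner_in[OF assms(1)] winner_max[OF assms(1,2)] assms(3) by force

lemma second_highest_le_iff:
  "second_highest_bid N a b \<le> c \<longleftrightarrow> 0 \<le> c \<and> (\<forall>j\<in>N - {a b}. b j \<le> c)"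
  unfolding second_highest_bid_def using finite_N by (subst Max_le_iff) auto

lemma second_highest_ge: "j \<in> N \<Longrightarrow> j \<noteq> a b \<Longrightarrow> b j \<le> second_highest_bid N a b"
  and second_highest_nonneg: "0 \<le> second_highest_bid N a b"
  unfolding second_highest_bid_def using finite_N by (auto intro!: Max_ge)

text \<open>This is where the ban on overbidding enters: every bid is at most the winning bid, which
  is at most the winner's valuation.\<close>

lemma welfare_bounds:
  assumes "b \<in> profiles G"
  shows "0 \<le> second_highest_bid N a b" "second_highest_bid N a b \<le> v (a b)"
proof -
  have "b j \<le> v (a b)" if "j \<in> N" for j
    using winner_max[OF assms that] profile_bounds[OF assms winner_in[OF assms]] by simp
  then show "second_highest_bid N a b \<le> v (a b)"
    using profile_bounds[OF assms winner_in[OF assms]] by (auto simp: second_highest_le_iff)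
qed (rule second_highest_nonneg)

text \<open>Losers have payoff 0, so the friendship sum has only the winner's term left.\<close>

lemma payoff_extension_auction:
  assumes "b \<in> profiles G"
  shows "payoff (friendship_extension \<alpha> G) i b =
    \<alpha> i (a b) * (v (a b) - second_highest_bid N a b)"
proof -
  have "payoff (friendship_extension \<alpha> G) i b =
      (\<Sum>j\<in>N. if j = a b then \<alpha> i j * (v j - second_highest_bid N a b) else 0)"
    by (auto simp: payoff_extension payoff_auction intro!: sum.cong)
  then show ?thesis
    using finite_N winner_in[OF assms] by simp
qed

section \<open>Measurability of winner, welfare and payoffs\<close>

lemma measurable_winner: "a \<in> profile_space G \<rightarrow>\<^sub>M count_space N"
proof -
  \<comment> \<open>The tie-breaking rule is measurable on all nonnegative bids; the inclusion of
    the bounded profiles carries this over.\<close>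
  have "(\<lambda>b. b) \<in> profile_space G \<rightarrow>\<^sub>M Pi\<^sub>M N (\<lambda>_. restrict_space borel {0..})"
  proof (rule measurable_PiM_single')
    fix i assume i: "i \<in> N"
    have "(\<lambda>b. b i) \<in> profile_space G \<rightarrow>\<^sub>M restrict_space borel {0..v i}"
      using measurable_component_singleton[OF i, of "\<lambda>i. restrict_space borel {0..v i}"]
      by (simp add: profile_space_def)
    then show "(\<lambda>b. b i) \<in> profile_space G \<rightarrow>\<^sub>M restrict_space borel {0..}"
      by (auto simp: measurable_restrict_space2_iff)
  qed (auto simp: space_profile_space profiles_def PiE_iff space_restrict_space)
  with rule_a show ?thesis
    unfolding highest_bidder_rule_def by (blast dest: measurable_compose)
qed

lemma measurable_bid:
  assumes "i \<in> N" shows "(\<lambda>b. b i) \<in> borel_measurable (profile_space G)"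
  using measurable_component_singleton[OF assms, of "\<lambda>i. restrict_space borel {0..v i}"]
  by (simp add: profile_space_def measurable_restrict_space2_iff)

lemma measurable_welfare: "(\<lambda>b. v (a b)) \<in> borel_measurable (profile_space G)"
  by (rule measurable_compose[OF measurable_winner]) simp

lemma measurable_payoff: "payoff G i \<in> borel_measurable (profile_space G)"
proof -
  \<comment> \<open>On the event that \<open>i\<close> wins, the maximum runs over an index set
    independent of \<open>b\<close>.\<close>
  have *: "payoff G i b = (if a b = i then v i - Max (insert 0 ((\<lambda>j. b j) ` (N - {i}))) else 0)" for b
    by (auto simp: payoff_auction second_highest_bid_def)
  have "(\<lambda>b. Max (insert 0 ((\<lambda>j. b j) ` (N - {i})))) \<in> borel_measurable (profile_space G)"
  \<comment> \<open>The inserted 0 splits off as \<open>max 0\<close> only if there are other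
    bidders.\<close>
  proof (cases "N - {i} = {}")
    case True
    show ?thesis unfolding True by simp
  next
    case False
    then have "Max (insert 0 ((\<lambda>j. b j) ` (N - {i}))) = max 0 (Max ((\<lambda>j. b j) ` (N - {i})))"
      for b :: "'i \<Rightarrow> real"
      using finite_N by (subst Max_insert) auto
    moreover have "(\<lambda>b. Max ((\<lambda>j. b j) ` (N - {i}))) \<in> borel_measurable (profile_space G)"
      using finite_N measurable_bid by (intro borel_measurable_Max) auto
    ultimately show ?thesis by simp
  qed
  moreover have "Measurable.pred (profile_space G) (\<lambda>b. a b = i)"
    by (rule measurable_compose[OF measurable_winner]) simp
  ultimately show ?thesis
    unfolding * by measurable
qed

lemma measurable_payoff_extension:
  "payoff (friendship_extension \<alpha> G) i \<in> borel_measurable (profile_space G)"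
  unfolding payoff_extension using measurable_payoff by measurable

section \<open>Upper bound\<close>

lemma payoff_extension_bounds:
  assumes "friendship_weights N \<alpha>" "b \<in> profiles G" "i \<in> N"
  shows "0 \<le> payoff (friendship_extension \<alpha> G) i b"
    and "payoff (friendship_extension \<alpha> G) i b \<le> v (a b)"
proof -
  have "0 \<le> \<alpha> i (a b)" "\<alpha> i (a b) \<le> 1"
    using assms winner_in by (auto simp: friendship_weights_def)
  \<comment> \<open>The winner's surplus lies between 0 and \<open>v (a b)\<close>, and a weight in
    the unit interval can only shrink it.\<close>
  with welfare_bounds[OF assms(2)]
  show "0 \<le> payoff (friendship_extension \<alpha> G) i b"
    "payoff (friendship_extension \<alpha> G) i b \<le> v (a b)"
    using mult_left_le_one_le[of "v (a b) - second_highest_bid N a b" "\<alpha> i (a b)"]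
    by (auto simp: payoff_extension_auction[OF assms(2)])
qed

lemma truthful_deviation:
  assumes w: "friendship_weights N \<alpha>" and b: "b \<in> profiles G" and k: "k \<in> N" and "0 \<le> v k"
  shows "v k - v (a b) \<le> payoff (friendship_extension \<alpha> G) k (b(k := v k))"
proof -
  let ?b = "b(k := v k)"
  have b': "?b \<in> profiles G"
    using profiles_upd[OF b] k \<open>0 \<le> v k\<close> by simp
  have le: "b j \<le> v (a b)" if "j \<in> N" for j
    using winner_max[OF b that] profile_bounds[OF b winner_in[OF b]] by simp
  show ?thesis
  proof (cases "a ?b = k")
    \<comment> \<open>On winning, \<open>k\<close> pays at most the largest of the other bids, which
      are the same as in \<open>b\<close> and hence at most \<open>v (a b)\<close>.\<close>
    case True
    have "second_highest_bid N a ?b \<le> v (a b)"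
      using le profile_bounds[OF b winner_in[OF b]] by (auto simp: second_highest_le_iff True)
    moreover have "\<alpha> k k = 1"
      using w k by (simp add: friendship_weights_def)
    ultimately show ?thesis
      by (simp add: payoff_extension_auction[OF b'] True)
  next
    \<comment> \<open>On losing, the new winner's bid is unchanged from \<open>b\<close> and at
      least \<open>v k\<close>. The left-hand side is then nonpositive, while payoffs are
      nonnegative.\<close>
    case False
    then have "v k \<le> v (a b)"
      using winner_max[OF b' k] le[OF winner_in[OF b']] by simp
    then show ?thesis
      using payoff_extension_bounds(1)[OF w b' k] by simp
  qed
qed

lemma valuation_le_twice_welfare:
  assumes w: "friendship_weights N \<alpha>" and eq: "coarse_equilibrium (friendship_extension \<alpha> G) \<sigma>"
    and k: "k \<in> N" and "0 \<le> v k"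
  shows "v k \<le> 2 * (\<integral>b. v (a b) \<partial>\<sigma>)"
proof -
  let ?P = "payoff (friendship_extension \<alpha> G) k"
  interpret prob_space \<sigma>
    using eq by (simp add: coarse_equilibrium_def)
  have sets: "sets \<sigma> = sets (profile_space G)"
    using eq by (simp add: coarse_equilibrium_def)
  have space: "space \<sigma> = profiles G"
    using sets_eq_imp_space_eq[OF sets] by (simp add: space_profile_space)
  have meas: "f \<in> borel_measurable \<sigma> \<longleftrightarrow> f \<in> borel_measurable (profile_space G)"
    for f :: "('i \<Rightarrow> real) \<Rightarrow> real"
    by (simp only: measurable_cong_sets[OF sets refl])
  \<comment> \<open>A crude uniform bound that makes welfare and payoffs integrable; absolute values
    appear because the locale puts no sign on \<open>v\<close>.\<close>
  define c where "c = (\<Sum>j\<in>N. \<bar>v j\<bar>)"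
  have c: "v j \<le> c" if "j \<in> N" for j
    using member_le_sum[OF that, of "\<lambda>j. \<bar>v j\<bar>"] finite_N by (simp add: c_def)
  have upd: "b(k := v k) \<in> profiles G" if "b \<in> profiles G" for b
    using profiles_upd[OF that] k \<open>0 \<le> v k\<close> by simp
  have bound: "\<bar>v (a b)\<bar> \<le> c" "\<bar>?P b\<bar> \<le> c" if "b \<in> profiles G" for b
    using payoff_extension_bounds[OF w that k] c[OF winner_in[OF that]] by auto
  have int_W: "integrable \<sigma> (\<lambda>b. v (a b))"
    by (rule integrable_const_bound[where B = c])
      (auto simp: space bound meas measurable_welfare)
  have int_P: "integrable \<sigma> ?P"
    by (rule integrable_const_bound[where B = c])
      (auto simp: space bound meas measurable_payoff_extension)
  have "(\<lambda>b. ?P (b(k := v k))) \<in> borel_measurable (profile_space G)"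
    using k \<open>0 \<le> v k\<close>
    by (intro measurable_compose[OF measurable_profile_upd measurable_payoff_extension]) auto
  then have int_Q: "integrable \<sigma> (\<lambda>b. ?P (b(k := v k)))"
    by (intro integrable_const_bound[where B = c]) (auto simp: space bound upd meas)
  have "v k - (\<integral>b. v (a b) \<partial>\<sigma>) = (\<integral>b. v k - v (a b) \<partial>\<sigma>)"
    using int_W by (simp add: prob_space)
  also have "\<dots> \<le> (\<integral>b. ?P (b(k := v k)) \<partial>\<sigma>)"
    using int_W int_Q truthful_deviation[OF w _ k \<open>0 \<le> v k\<close>]
    by (intro integral_mono) (auto simp: space)
  also have "\<dots> \<le> (\<integral>b. ?P b \<partial>\<sigma>)"
    using eq k \<open>0 \<le> v k\<close> by (simp add: coarse_equilibrium_def)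
  also have "\<dots> \<le> (\<integral>b. v (a b) \<partial>\<sigma>)"
    using int_W int_P payoff_extension_bounds(2)[OF w _ k]
    by (intro integral_mono) (auto simp: space)
  finally show ?thesis by simp
qed

lemma coarse_poa_class_le_2:
  assumes v: "v \<in> N \<rightarrow> {0..}"
  shows "coarse_poa_class (friendship_extensions G) \<le> 2"
proof -
  have "ereal (v (a b)) / ereal (\<integral>b. v (a b) \<partial>\<sigma>) \<le> 2"
    if w: "friendship_weights N \<alpha>" and b: "b \<in> profiles G"
      and eq: "coarse_equilibrium (friendship_extension \<alpha> G) \<sigma>" for \<alpha> b \<sigma>
  proof -
    have nonneg: "0 \<le> v (a b)"
      using v winner_in[OF b] by auto
    have le: "v (a b) \<le> 2 * (\<integral>b. v (a b) \<partial>\<sigma>)"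
      using valuation_le_twice_welfare[OF w eq winner_in[OF b] nonneg] .
    show ?thesis
    proof (cases "(\<integral>b. v (a b) \<partial>\<sigma>) = 0")
      \<comment> \<open>Here \<open>le\<close> forces the numerator to vanish too, and 0/0 counts as
        0.\<close>
      case True
      with le nonneg show ?thesis by (simp add: zero_ereal_def[symmetric])
    next
      case False
      with le nonneg have "0 < (\<integral>b. v (a b) \<partial>\<sigma>)" by linarith
      with le have "v (a b) / (\<integral>b. v (a b) \<partial>\<sigma>) \<le> 2" by (simp add: field_simps)
      with False show ?thesis by simp
    qed
  qed
  then have "coarse_poa (friendship_extension \<alpha> G) \<le> 2" if "friendship_weights N \<alpha>" for \<alpha>
    unfolding coarse_poa_def using that
    by (intro Sup_least) (auto simp: is_arg_max_def simp del: ereal_divide)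
  then show ?thesis
    unfolding coarse_poa_class_def friendship_extensions_def by (auto intro!: SUP_least)
qed

end

section \<open>Lower bound\<close>

lemma coarse_poa_example:
  fixes N :: "'i set"
  assumes "finite N" "highest_bidder_rule N a" and pq: "p \<in> N" "q \<in> N" "p \<noteq> q"
  defines "v \<equiv> (\<lambda>i. if i = p then 2 else if i = q then 1 else 0)"
    and "\<alpha> \<equiv> (\<lambda>i j. if i = j \<or> i = p then 1 else 0)"
  shows "2 \<le> coarse_poa (friendship_extension \<alpha> (second_price_auction N a v))"
proof -
  interpret auction N a v
    using assms by unfold_locales
  let ?H = "friendship_extension \<alpha> G"
  \<comment> \<open>\<open>b\<close> is the bad equilibrium won by \<open>q\<close>, and
    \<open>b_opt\<close> an optimum won by \<open>p\<close>. Each has a strict highest bid, so the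
    winners do not depend on the tie-breaking.\<close>
  define b where "b = (\<lambda>i\<in>N. if i = q then 1 else 0 :: real)"
  define b_opt where "b_opt = (\<lambda>i\<in>N. if i = p then 2 else 0 :: real)"
  have b: "b \<in> profiles G" and b_opt: "b_opt \<in> profiles G"
    by (auto simp: profiles_def b_def b_opt_def v_def pq)
  have win: "a b = q" "a b_opt = p"
    using b b_opt pq by (auto intro!: winner_eqI simp: b_def b_opt_def)
  have "b j \<le> 0" if "j \<in> N - {a b}" for j
    using that unfolding win by (simp add: b_def)
  then have second: "second_highest_bid N a b = 0"
    using second_highest_nonneg[of b] second_highest_le_iff[of b 0] by auto
  have opt: "is_arg_max (welfare ?H) (\<lambda>b. b \<in> profiles ?H) b_opt"
    using b_opt by (auto simp: is_arg_max_def win) (auto simp: v_def split: if_split_asm)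
  have payoff_b: "payoff ?H i b = (if i = p \<or> i = q then 1 else 0)" for i
    using pq by (simp add: payoff_extension_auction[OF b] win second) (auto simp: v_def \<alpha>_def)
  have nash: "payoff ?H i (b(i := t)) \<le> payoff ?H i b" if i: "i \<in> N" and t: "t \<in> {0..v i}" for i t
  proof -
    let ?b = "b(i := t)"
    have b': "?b \<in> profiles G"
      using profiles_upd[OF b] i t by simp
    consider "i = p" | "i = q" | "i \<noteq> p" "i \<noteq> q" by blast
    then show ?thesis
    proof cases
      case 1
      \<comment> \<open>If \<open>p\<close> wins, the bid 1 of \<open>q\<close> sets a price of at
        least 1 against valuation 2; any other winner has valuation at most 1.\<close>
      have "v (a ?b) - second_highest_bid N a ?b \<le> 1"
        using second_highest_ge[of q ?b] second_highest_nonneg[of ?b] pq 1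
        by (cases "a ?b = p") (auto simp: v_def b_def)
      then show ?thesis
        unfolding payoff_b payoff_extension_auction[OF b'] using 1 by (simp add: \<alpha>_def)
    next
      case 2
      \<comment> \<open>Bidder \<open>q\<close> values only the own utility, which never exceeds
        \<open>v q = 1\<close>.\<close>
      then show ?thesis
        unfolding payoff_b payoff_extension_auction[OF b']
        using pq second_highest_nonneg[of ?b] by (auto simp: \<alpha>_def v_def)
    next
      case 3
      \<comment> \<open>Valuation 0 leaves 0 as the only admissible bid.\<close>
      then have "?b = b"
        using i t by (auto simp: v_def b_def)
      then show ?thesis by simp
    qed
  qed
  let ?\<sigma> = "return (profile_space G) b"
  have "coarse_equilibrium ?H (return (profile_space ?H) b)"
    by (rule coarse_equilibrium_return)
      (use b nash in \<open>auto simp: measurable_payoff_extension\<close>)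
  then have eq: "coarse_equilibrium ?H ?\<sigma>" by simp
  have "(\<integral>b. welfare ?H b \<partial>?\<sigma>) = v q"
    using b measurable_welfare by (simp add: integral_return space_profile_space win)
  then have "ereal (welfare ?H b_opt) / ereal (\<integral>b. welfare ?H b \<partial>?\<sigma>) = 2"
    using pq by (simp add: win v_def)
  then show ?thesis
    unfolding coarse_poa_def using opt eq by (intro Sup_upper CollectI) metis
qed

text \<open>The upper bound holds for each fixed \<open>v\<close>, whereas the value 2 is that of
  the class with \<open>v\<close> varying as well. Two bidders are required for it because a sole
  bidder always wins, so that welfare is always optimal.\<close>

theorem theorem10:
  fixes N :: "'i set" and a :: "('i \<Rightarrow> real) \<Rightarrow> 'i"
  assumes "finite N" and "N \<noteq> {}" and "highest_bidder_rule N a"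
  shows "(\<forall>v \<in> N \<rightarrow> {0..}.
            coarse_poa_class (friendship_extensions (second_price_auction N a v)) \<le> 2) \<and>
         (card N \<ge> 2 \<longrightarrow>
            coarse_poa_class
              (\<Union>v \<in> N \<rightarrow> {0..}. friendship_extensions (second_price_auction N a v)) = 2)"
proof (intro conjI impI)
  show upper: "\<forall>v \<in> N \<rightarrow> {0..}.
      coarse_poa_class (friendship_extensions (second_price_auction N a v)) \<le> 2"
    using auction.coarse_poa_class_le_2 assms by (auto simp: auction_def)
  assume "card N \<ge> 2"
  then obtain p q where pq: "p \<in> N" "q \<in> N" "p \<noteq> q"
    by (metis card_2_iff' obtain_subset_with_card_n subset_iff)
  show "coarse_poa_class
      (\<Union>v \<in> N \<rightarrow> {0..}. friendship_extensions (second_price_auction N a v)) = 2"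
  proof (rule antisym)
    show "coarse_poa_class
        (\<Union>v \<in> N \<rightarrow> {0..}. friendship_extensions (second_price_auction N a v)) \<le> 2"
      using upper by (simp add: coarse_poa_class_def SUP_le_iff)
    show "2 \<le> coarse_poa_class
        (\<Union>v \<in> N \<rightarrow> {0..}. friendship_extensions (second_price_auction N a v))"
      unfolding coarse_poa_class_def
      using coarse_poa_example[OF assms(1,3) pq]
      by (rule SUP_upper2[rotated])
        (auto simp: friendship_extensions_def friendship_weights_def
          intro!: bexI[of _ "\<lambda>i. if i = p then 2 else if i = q then 1 else 0"]
            exI[of _ "\<lambda>i j. if i = j \<or> i = p then 1 else 0"])
  qed
qed

end
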